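(* Let $(v_j,\sigma_j^2)_j$ be the eigenvectors and eigenvalues of $A=\mathcal{A}^*\mathcal{A}$, let $L\in(0,1)$ and let $\varphi_\theta=\mathrm{Id}-f_\theta$ be an iResNet which solves the training problem $$\min_{\theta\in\Theta}\ \frac1N\sum_{i=1}^N\|\varphi_\theta(x^{(i)})-Ax^{(i)}\|^2\quad\text{s.t. }\mathrm{Lip}(f_\theta)\leqslant L,$$ where (i) $f_\theta=k(\mathrm{Id}-A)$ with $\theta=k$ and $\Theta=\mathbb{R}$ (architecture assumption), (ii) the training dataset $\{x^{(i)}\}_{i\in\{1,\dots,N\}}\subset X$ contains at least one $x^{(i)}$ such that $Ax^{(i)}\neq x^{(i)}$ (dataset assumption). Then the solution of the training problem is $k=L$, and for $z\in\mathcal{R}(\mathcal{A}^* )$ $$\varphi_\theta^{-1}(z)=\sum_{j\in\mathbb{N}}r_L(\sigma_j^2,\langle z,v_j\rangle)\,\langle z,v_j\rangle\,v_j$$ holds with $$r_L(\sigma^2,s)=\frac1L\cdot\frac{1}{\alpha+\sigma^2},\qquad\alpha=\frac{1-L}{L},$$ for any $s\in\mathbb{R}$.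
   Context: $X,Y$ are Hilbert spaces and $\mathcal{A}:X\to Y$ is a bounded linear operator with $\|\mathcal{A}\|=1$. $\mathcal{A}$ is assumed to have a singular value decomposition $(u_j,v_j,\sigma_j)_{j\in\mathbb{N}}$ (finitely many $j$ if the range is finite-dimensional), i.e. $\mathcal{A}x=\sum_j\sigma_j\langle x,v_j\rangle u_j$ with $\sigma_j>0$, $(u_j)$ orthonormal in $Y$ and $(v_j)$ an orthonormal basis of $\mathcal{N}(\mathcal{A})^\perp$; hence $\sigma_j\in(0,1]$, and $(v_j,\sigma_j^2)$ are the eigenvectors and (non-zero) eigenvalues of $A=\mathcal{A}^*\mathcal{A}$. $\mathcal{N}$ and $\mathcal{R}$ denote null space and range, and $\mathrm{Lip}(f)$ denotes the Lipschitz constant of $f:X\to X$. An iResNet is a map $\varphi_\theta=\mathrm{Id}-f_\theta:X\to X$ with $\mathrm{Lip}(f_\theta)\leqslant L<1$; it is bijective on $X$.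
   Formalization: Assumes in addition that 𝒜 is not bounded below (nontrivial null space, or inf σ_j = 0); otherwise ‖Id−A‖<1 and the solution is k = min(1, L/‖Id−A‖) > L, e.g. 𝒜 = diag(1, 1/√2), L = 1/2 gives k = 1. *)

theory Defs
  imports "HOL-Analysis.Analysis"
begin

text \<open>Real Hilbert spaces are the types of sort \<open>{real_inner, complete_space}\<close>.\<close>

definition orthonormal_family :: "nat set \<Rightarrow> (nat \<Rightarrow> 'a::real_inner) \<Rightarrow> bool" where
  "orthonormal_family J e \<longleftrightarrow> (\<forall>i\<in>J. \<forall>j\<in>J. e i \<bullet> e j = (if i = j then 1 else 0))"

definition null_space :: "('a::real_vector \<Rightarrow> 'b::real_vector) \<Rightarrow> 'a set" where
  "null_space \<A> = {x. \<A> x = 0}"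

text \<open>The index set \<open>J\<close> is a set of naturals, so that it may be finite. For orthogonal terms in a
  Hilbert space, unordered convergence (\<open>has_sum\<close>) over \<open>J\<close> is equivalent to convergence of the
  series in the order of the indices.\<close>

definition singular_value_decomposition ::
    "('a::real_inner \<Rightarrow> 'b::real_inner) \<Rightarrow> nat set \<Rightarrow> (nat \<Rightarrow> 'b) \<Rightarrow> (nat \<Rightarrow> 'a) \<Rightarrow> (nat \<Rightarrow> real) \<Rightarrow> bool" where
  "singular_value_decomposition \<A> J u v \<sigma> \<longleftrightarrow>
     (\<forall>j\<in>J. \<sigma> j > 0) \<and>
     orthonormal_family J u \<and>
     orthonormal_family J v \<and>
     closure (span (v ` J)) = (null_space \<A>)\<^sup>\<bottom> \<and>
     (\<forall>x. ((\<lambda>j. (\<sigma> j * (x \<bullet> v j)) *\<^sub>R u j) has_sum \<A> x) J)"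

text \<open>Failure of a stability estimate: \<open>\<A>\<close> is not injective, or its inverse on the range is
  unbounded. In terms of the singular values this says that \<open>\<A>\<close> has a nontrivial null space or that
  the \<open>\<sigma> j\<close> are not bounded away from zero, as is automatic for a compact operator on an
  infinite-dimensional space.\<close>

definition ill_posed :: "('a::real_normed_vector \<Rightarrow> 'b::real_normed_vector) \<Rightarrow> bool" where
  "ill_posed \<A> \<longleftrightarrow> \<not> (\<exists>c>0. \<forall>x. c * norm x \<le> norm (\<A> x))"

definition iresnet :: "('a \<Rightarrow> 'a) \<Rightarrow> 'a \<Rightarrow> 'a::real_vector" where
  "iresnet f = (\<lambda>x. x - f x)"

definition training_loss ::
    "('a \<Rightarrow> 'a) \<Rightarrow> ('p \<Rightarrow> 'a \<Rightarrow> 'a) \<Rightarrow> nat \<Rightarrow> (nat \<Rightarrow> 'a::real_normed_vector) \<Rightarrow> 'p \<Rightarrow> real" where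
  "training_loss A f N x \<theta> =
     1 / real N * (\<Sum>i=1..N. (norm (iresnet (f \<theta>) (x i) - A (x i)))\<^sup>2)"

text \<open>The constraint \<open>Lip (f \<theta>) \<le> L\<close> is \<open>L-lipschitz_on UNIV (f \<theta>)\<close>.\<close>

definition solves_training_problem ::
    "('a \<Rightarrow> 'a) \<Rightarrow> 'p set \<Rightarrow> ('p \<Rightarrow> 'a \<Rightarrow> 'a) \<Rightarrow> real \<Rightarrow> nat \<Rightarrow> (nat \<Rightarrow> 'a::real_normed_vector) \<Rightarrow> 'p \<Rightarrow> bool" where
  "solves_training_problem A \<Theta> f L N x \<theta> \<longleftrightarrow>
     is_arg_min (training_loss A f N x) (\<lambda>\<theta>. \<theta> \<in> \<Theta> \<and> L-lipschitz_on UNIV (f \<theta>)) \<theta>"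

text \<open>The first filter argument is the squared singular value; the filter does not depend on the
  second one.\<close>

definition filter_function :: "real \<Rightarrow> real \<Rightarrow> real \<Rightarrow> real" where
  "filter_function L t s = (let \<alpha> = (1 - L) / L in 1 / L * (1 / (\<alpha> + t)))"

end

theory Submission
  imports Defs
begin

text \<open>
  Write \<open>T\<close> for the operator and \<open>G = Id - T\<^sup>* T\<close>. The residual of the training problem at a data
  point \<open>y\<close> is \<open>(y - k G y) - (y - G y) = (1 - k) G y\<close>, so the loss is \<open>C (1 - k)\<^sup>2\<close>, where the
  dataset assumption makes the constant \<open>C\<close> positive. Everything thus depends on which \<open>k\<close> are
  admissible, that is, on the Lipschitz constant of \<open>G\<close>, which is exactly \<open>1\<close>. It is at most \<open>1\<close>
  because
  \<open>\<parallel>G x\<parallel>\<^sup>2 = \<parallel>x\<parallel>\<^sup>2 - 2 \<parallel>T x\<parallel>\<^sup>2 + \<parallel>T\<^sup>* T x\<parallel>\<^sup>2 \<le> \<parallel>x\<parallel>\<^sup>2\<close> when \<open>\<parallel>T\<parallel> \<le> 1\<close>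
  (\<open>norm_id_minus_normal_operator_le\<close>), and at least \<open>1\<close> because ill-posedness provides vectors \<open>x\<close>
  with \<open>\<parallel>T x\<parallel> / \<parallel>x\<parallel>\<close> arbitrarily small, which \<open>G\<close> barely moves
  (\<open>lipschitz_scaled_id_minus_normal_operator_iff\<close>). Hence the constraint reads \<open>\<bar>k\<bar> \<le> L < 1\<close>, and the
  loss is minimal exactly at the right end \<open>k = L\<close>.

  The network \<open>Id - L G = (1 - L) Id + L T\<^sup>* T\<close> is bijective by Banach's fixed point theorem. If it
  sends \<open>x\<close> to some \<open>z\<close> in the range of \<open>T\<^sup>*\<close>, then \<open>(1 - L) x = z - L T\<^sup>* T x\<close> lies in that range
  too. So \<open>x\<close> is orthogonal to the null space of \<open>T\<close> and equals the sum of its Fourier series in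
  the right singular vectors; comparing the coefficients
  \<open>z \<bullet> v j = (1 - L + L (\<sigma> j)\<^sup>2) (x \<bullet> v j)\<close> yields the filter (\<open>svd_expansion_affine_inverse\<close>).

  The function \<open>adjoint\<close> is a choice that means something only once an adjoint exists. Existence
  follows from the singular system: \<open>T\<^sup>* y = (\<Sum>j. \<sigma> j (y \<bullet> u j) v j)\<close>, a series that converges since
  its coefficients are square summable (\<open>summable_on_orthonormal\<close>, \<open>svd_adjoint\<close>).
\<close>

section \<open>Orthonormal families\<close>

lemma inner_orthonormal_sum:
  assumes "orthonormal_family J e" "F \<subseteq> J" "finite F" "i \<in> J"
  shows "(\<Sum>j\<in>F. c j *\<^sub>R e j) \<bullet> e i = (if i \<in> F then c i else 0)"
proof -
  have "(\<Sum>j\<in>F. c j *\<^sub>R e j) \<bullet> e i = (\<Sum>j\<in>F. if j = i then c j else 0)"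
    unfolding inner_sum_left using assms
    by (intro sum.cong) (auto simp: orthonormal_family_def)
  also have "\<dots> = (if i \<in> F then c i else 0)"
    using assms(3) by simp
  finally show ?thesis .
qed

lemma norm_orthonormal_sum:
  assumes "orthonormal_family J e" "F \<subseteq> J" "finite F"
  shows "(norm (\<Sum>j\<in>F. c j *\<^sub>R e j))\<^sup>2 = (\<Sum>j\<in>F. (c j)\<^sup>2)"
proof -
  have "(norm (\<Sum>j\<in>F. c j *\<^sub>R e j))\<^sup>2 = (\<Sum>i\<in>F. c i * ((\<Sum>j\<in>F. c j *\<^sub>R e j) \<bullet> e i))"
    unfolding power2_norm_eq_inner
    using inner_sum_right[of "\<Sum>j\<in>F. c j *\<^sub>R e j" "\<lambda>j. c j *\<^sub>R e j" F] by simp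
  also have "\<dots> = (\<Sum>i\<in>F. (c i)\<^sup>2)"
    using assms by (intro sum.cong) (auto simp: inner_orthonormal_sum subsetD power2_eq_square)
  finally show ?thesis .
qed

text \<open>Pythagoras for the orthogonal projection onto the span of a finite subfamily. Bessel's
  inequality and the contraction property of the residual are its two immediate consequences.\<close>

lemma norm_orthonormal_residual:
  assumes "orthonormal_family J e" "F \<subseteq> J" "finite F"
  shows "(norm (x - (\<Sum>j\<in>F. (x \<bullet> e j) *\<^sub>R e j)))\<^sup>2 = (norm x)\<^sup>2 - (\<Sum>j\<in>F. (x \<bullet> e j)\<^sup>2)"
proof -
  let ?p = "\<Sum>j\<in>F. (x \<bullet> e j) *\<^sub>R e j"
  have "x \<bullet> ?p = (\<Sum>j\<in>F. (x \<bullet> e j)\<^sup>2)"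
    by (simp add: inner_sum_right power2_eq_square)
  moreover have "?p \<bullet> ?p = (\<Sum>j\<in>F. (x \<bullet> e j)\<^sup>2)"
    using norm_orthonormal_sum[OF assms] by (simp add: power2_norm_eq_inner)
  ultimately show ?thesis
    by (simp add: power2_norm_eq_inner inner_diff_left inner_diff_right inner_commute)
qed

lemma Bessel_inequality:
  assumes "orthonormal_family J e" "F \<subseteq> J" "finite F"
  shows "(\<Sum>j\<in>F. (x \<bullet> e j)\<^sup>2) \<le> (norm x)\<^sup>2"
  using norm_orthonormal_residual[OF assms, of x]
    zero_le_power2[of "norm (x - (\<Sum>j\<in>F. (x \<bullet> e j) *\<^sub>R e j))"] by linarith

lemma norm_orthonormal_residual_le:
  assumes "orthonormal_family J e" "F \<subseteq> J" "finite F"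
  shows "norm (x - (\<Sum>j\<in>F. (x \<bullet> e j) *\<^sub>R e j)) \<le> norm x"
proof (rule power2_le_imp_le)
  have "0 \<le> (\<Sum>j\<in>F. (x \<bullet> e j)\<^sup>2)" by (simp add: sum_nonneg)
  then show "(norm (x - (\<Sum>j\<in>F. (x \<bullet> e j) *\<^sub>R e j)))\<^sup>2 \<le> (norm x)\<^sup>2"
    unfolding norm_orthonormal_residual[OF assms] by linarith
qed simp

text \<open>A vector in the span is a combination of finitely many members, and projecting onto any
  larger finite subfamily leaves it unchanged.\<close>

lemma orthonormal_expansion_in_span:
  assumes e: "orthonormal_family J e" and y: "y \<in> span (e ` J)"
  shows "\<exists>G. finite G \<and> G \<subseteq> J \<and>
    (\<forall>F. finite F \<longrightarrow> G \<subseteq> F \<longrightarrow> F \<subseteq> J \<longrightarrow> (\<Sum>j\<in>F. (y \<bullet> e j) *\<^sub>R e j) = y)"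
  using y
proof (induction rule: span_induct_alt)
  case base
  show ?case by (intro exI[of _ "{}"]) simp
next
  case (step c x y)
  then obtain i where i: "i \<in> J" "x = e i" by blast
  from step.IH obtain G where G: "finite G" "G \<subseteq> J"
    "\<And>F. finite F \<Longrightarrow> G \<subseteq> F \<Longrightarrow> F \<subseteq> J \<Longrightarrow> (\<Sum>j\<in>F. (y \<bullet> e j) *\<^sub>R e j) = y" by auto
  show ?case
  proof (intro exI[of _ "insert i G"] conjI allI impI)
    fix F assume F: "finite F" "insert i G \<subseteq> F" "F \<subseteq> J"
    have "(\<Sum>j\<in>F. (x \<bullet> e j) *\<^sub>R e j) = (\<Sum>j\<in>F. if j = i then e j else 0)"
      using e i F by (intro sum.cong) (auto simp: orthonormal_family_def subset_eq)
    also have "\<dots> = x" using F i by simp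
    finally have "(\<Sum>j\<in>F. (x \<bullet> e j) *\<^sub>R e j) = x" .
    moreover have "(\<Sum>j\<in>F. ((c *\<^sub>R x + y) \<bullet> e j) *\<^sub>R e j)
        = c *\<^sub>R (\<Sum>j\<in>F. (x \<bullet> e j) *\<^sub>R e j) + (\<Sum>j\<in>F. (y \<bullet> e j) *\<^sub>R e j)"
      by (simp add: inner_add_left scaleR_add_left sum.distrib scaleR_sum_right)
    ultimately show "(\<Sum>j\<in>F. ((c *\<^sub>R x + y) \<bullet> e j) *\<^sub>R e j) = c *\<^sub>R x + y"
      using G(3)[of F] F by simp
  qed (use G i in auto)
qed

text \<open>The map from a vector to its distance from the projection is nonexpansive, uniformly in the
  finite subfamily, and it is eventually zero on the span; hence it tends to zero on the closure.\<close>

lemma has_sum_orthonormal_expansion: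
  assumes e: "orthonormal_family J e" and x: "x \<in> closure (span (e ` J))"
  shows "((\<lambda>j. (x \<bullet> e j) *\<^sub>R e j) has_sum x) J"
  unfolding has_sum_def
proof (rule tendstoI)
  fix \<epsilon> :: real assume "\<epsilon> > 0"
  then have "\<exists>y\<in>span (e ` J). dist y x < \<epsilon>"
    using x by (simp only: closure_approachable)
  then obtain y where y: "y \<in> span (e ` J)" "dist y x < \<epsilon>"
    by blast
  obtain G where G: "finite G" "G \<subseteq> J"
    "\<And>F. finite F \<Longrightarrow> G \<subseteq> F \<Longrightarrow> F \<subseteq> J \<Longrightarrow> (\<Sum>j\<in>F. (y \<bullet> e j) *\<^sub>R e j) = y"
    using orthonormal_expansion_in_span[OF e y(1)] by auto
  have "dist (\<Sum>j\<in>F. (x \<bullet> e j) *\<^sub>R e j) x < \<epsilon>" if F: "finite F" "G \<subseteq> F" "F \<subseteq> J" for F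
  proof -
    have "(\<Sum>j\<in>F. ((x - y) \<bullet> e j) *\<^sub>R e j) = (\<Sum>j\<in>F. (x \<bullet> e j) *\<^sub>R e j) - y"
      using G(3)[OF F] by (simp add: inner_diff_left scaleR_diff_left sum_subtractf)
    then have "x - y - (\<Sum>j\<in>F. ((x - y) \<bullet> e j) *\<^sub>R e j) = x - (\<Sum>j\<in>F. (x \<bullet> e j) *\<^sub>R e j)"
      by (simp only: diff_diff_eq2 diff_add_cancel)
    then have "norm (x - (\<Sum>j\<in>F. (x \<bullet> e j) *\<^sub>R e j)) \<le> norm (x - y)"
      using norm_orthonormal_residual_le[OF e F(3,1), of "x - y"] by (simp only:)
    also have "\<dots> < \<epsilon>"
      using y(2) by (simp only: dist_norm norm_minus_commute)
    finally show ?thesis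
      by (simp only: dist_norm norm_minus_commute)
  qed
  then show "\<forall>\<^sub>F F in finite_subsets_at_top J. dist (\<Sum>j\<in>F. (x \<bullet> e j) *\<^sub>R e j) x < \<epsilon>"
    unfolding eventually_finite_subsets_at_top using G(1,2) by blast
qed

text \<open>The Riesz--Fischer theorem: by Pythagoras the partial sums form a Cauchy net, since
  the squared norm of a finite block of terms is a block of the convergent series of squares.\<close>

lemma summable_on_orthonormal:
  fixes e :: "nat \<Rightarrow> 'a::{real_inner, complete_space}"
  assumes e: "orthonormal_family J e" and c: "(\<lambda>j. (c j)\<^sup>2) summable_on J"
  shows "(\<lambda>j. c j *\<^sub>R e j) summable_on J"
proof -
  obtain S where S: "((\<lambda>j. (c j)\<^sup>2) has_sum S) J"
    using c by (auto simp: summable_on_def)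
  have "\<exists>P. eventually P (finite_subsets_at_top J) \<and>
      (\<forall>F F'. P F \<and> P F' \<longrightarrow> dist (\<Sum>j\<in>F. c j *\<^sub>R e j) (\<Sum>j\<in>F'. c j *\<^sub>R e j) < \<epsilon>)"
    if "\<epsilon> > 0" for \<epsilon> :: real
  proof -
    \<comment> \<open>Blocks beyond \<open>G\<close> have squares summing to less than \<open>2 d = (\<epsilon> / 2)\<^sup>2\<close>, so every partial sum over
      a superset of \<open>G\<close> is within \<open>\<epsilon> / 2\<close> of the one over \<open>G\<close>.\<close>
    define d where "d = (\<epsilon> / 2)\<^sup>2 / 2"
    have "d > 0" using that by (simp add: d_def)
    then have "\<forall>\<^sub>F F in finite_subsets_at_top J. dist (\<Sum>j\<in>F. (c j)\<^sup>2) S < d"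
      using S by (auto simp: has_sum_def tendsto_iff)
    then have "\<exists>G. finite G \<and> G \<subseteq> J \<and>
        (\<forall>F. finite F \<and> G \<subseteq> F \<and> F \<subseteq> J \<longrightarrow> dist (\<Sum>j\<in>F. (c j)\<^sup>2) S < d)"
      by (simp only: eventually_finite_subsets_at_top)
    then obtain G where G: "finite G" "G \<subseteq> J"
      "\<forall>F. finite F \<and> G \<subseteq> F \<and> F \<subseteq> J \<longrightarrow> dist (\<Sum>j\<in>F. (c j)\<^sup>2) S < d"
      by (elim exE conjE)
    define P where "P F \<longleftrightarrow> finite F \<and> G \<subseteq> F \<and> F \<subseteq> J" for F
    have near: "dist (\<Sum>j\<in>F. c j *\<^sub>R e j) (\<Sum>j\<in>G. c j *\<^sub>R e j) < \<epsilon> / 2" if "P F" for F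
    proof -
      have F: "finite F" "G \<subseteq> F" "F \<subseteq> J" using that by (auto simp: P_def)
      have "(norm (\<Sum>j\<in>F - G. c j *\<^sub>R e j))\<^sup>2 = (\<Sum>j\<in>F - G. (c j)\<^sup>2)"
        using F by (intro norm_orthonormal_sum[OF e]) auto
      also have "\<dots> = (\<Sum>j\<in>F. (c j)\<^sup>2) - (\<Sum>j\<in>G. (c j)\<^sup>2)"
        using F by (simp add: sum_diff)
      also have "\<dots> < 2 * d"
        using G(3)[rule_format, of F] G(3)[rule_format, of G] G(1,2) F
        unfolding dist_real_def by force
      also have "\<dots> = (\<epsilon> / 2)\<^sup>2" by (simp add: d_def)
      finally have "norm (\<Sum>j\<in>F - G. c j *\<^sub>R e j) < \<epsilon> / 2"
        using \<open>\<epsilon> > 0\<close> by (intro power2_less_imp_less[of _ "\<epsilon> / 2"]) auto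
      then show ?thesis
        using F by (simp add: dist_norm sum_diff)
    qed
    have "eventually P (finite_subsets_at_top J)"
      unfolding eventually_finite_subsets_at_top P_def using G(1,2) by (intro exI[of _ G]) simp
    moreover have "dist (\<Sum>j\<in>F. c j *\<^sub>R e j) (\<Sum>j\<in>F'. c j *\<^sub>R e j) < \<epsilon>" if "P F" "P F'" for F F'
      using near[OF that(1)] near[OF that(2)] by (rule dist_triangle_half_l)
    ultimately show ?thesis by blast
  qed
  then have "cauchy_filter (filtermap (sum (\<lambda>j. c j *\<^sub>R e j)) (finite_subsets_at_top J))"
    by (simp add: cauchy_filter_metric_filtermap)
  then have "convergent_filter (filtermap (sum (\<lambda>j. c j *\<^sub>R e j)) (finite_subsets_at_top J))"
    by (rule cauchy_filter_convergent)
  then show ?thesis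
    by (auto simp: convergent_filter_iff summable_on_def has_sum_def filterlim_def)
qed

section \<open>Singular systems and the adjoint\<close>

lemma svd_apply_right_singular_vector:
  assumes svd: "singular_value_decomposition T J u v \<sigma>" and j: "j \<in> J"
  shows "T (v j) = \<sigma> j *\<^sub>R u j"
proof -
  have "((\<lambda>i. (\<sigma> i * (v j \<bullet> v i)) *\<^sub>R u i) has_sum \<sigma> j *\<^sub>R u j) J"
    by (rule has_sum_finite_neutralI[of "{j}"])
       (use svd j in \<open>auto simp: singular_value_decomposition_def orthonormal_family_def\<close>)
  moreover have "((\<lambda>i. (\<sigma> i * (v j \<bullet> v i)) *\<^sub>R u i) has_sum T (v j)) J"
    using svd by (simp add: singular_value_decomposition_def)
  ultimately show ?thesis by (metis has_sum_unique)
qed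

lemma svd_inner_left_singular_vector:
  assumes svd: "singular_value_decomposition T J u v \<sigma>" and j: "j \<in> J"
  shows "T x \<bullet> u j = \<sigma> j * (x \<bullet> v j)"
proof -
  have "((\<lambda>i. ((\<sigma> i * (x \<bullet> v i)) *\<^sub>R u i) \<bullet> u j) has_sum T x \<bullet> u j) J"
    using svd has_sum_bounded_linear[OF bounded_linear_inner_left[of "u j"]]
    unfolding singular_value_decomposition_def by blast
  moreover have "((\<lambda>i. ((\<sigma> i * (x \<bullet> v i)) *\<^sub>R u i) \<bullet> u j) has_sum \<sigma> j * (x \<bullet> v j)) J"
    by (rule has_sum_finite_neutralI[of "{j}"])
       (use svd j in \<open>auto simp: singular_value_decomposition_def orthonormal_family_def\<close>)
  ultimately show ?thesis by (metis has_sum_unique)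
qed

lemma svd_singular_value_le_onorm:
  assumes "bounded_linear T" and svd: "singular_value_decomposition T J u v \<sigma>" and j: "j \<in> J"
  shows "\<sigma> j \<le> onorm T"
proof -
  have "v j \<bullet> v j = 1" "u j \<bullet> u j = 1" "\<sigma> j > 0"
    using svd j by (simp_all add: singular_value_decomposition_def orthonormal_family_def)
  then have "norm (v j) = 1" "norm (u j) = 1" "\<sigma> j > 0"
    by (simp_all only: norm_eq_1)
  then show ?thesis
    using onorm[OF assms(1), of "v j"] svd_apply_right_singular_vector[OF svd j] by simp
qed

text \<open>The series \<open>B y\<close> below is an adjoint: its coefficients are square summable by Bessel's
  inequality for \<open>u\<close> and \<open>\<sigma> j \<le> onorm T\<close>, and both \<open>T x \<bullet> y\<close> and \<open>x \<bullet> B y\<close> are the sum of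
  \<open>\<sigma> j (x \<bullet> v j) (u j \<bullet> y)\<close>. Uniqueness then identifies it with \<open>adjoint T\<close>.\<close>

lemma svd_adjoint:
  fixes T :: "'a::{real_inner, complete_space} \<Rightarrow> 'b::real_inner"
  assumes T: "bounded_linear T" and svd: "singular_value_decomposition T J u v \<sigma>"
  shows "T x \<bullet> y = x \<bullet> adjoint T y"
proof -
  have u: "orthonormal_family J u" and v: "orthonormal_family J v"
    and pos: "\<And>j. j \<in> J \<Longrightarrow> \<sigma> j > 0"
    and T_sum: "\<And>x. ((\<lambda>j. (\<sigma> j * (x \<bullet> v j)) *\<^sub>R u j) has_sum T x) J"
    using svd by (auto simp: singular_value_decomposition_def)
  define B where "B y = (\<Sum>\<^sub>\<infinity>j\<in>J. (\<sigma> j * (y \<bullet> u j)) *\<^sub>R v j)" for y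
  have B_sum: "((\<lambda>j. (\<sigma> j * (y \<bullet> u j)) *\<^sub>R v j) has_sum B y) J" for y
    unfolding B_def
  proof (intro has_sum_infsum summable_on_orthonormal[OF v] nonneg_bdd_above_summable_on)
    have "(\<Sum>j\<in>F. (\<sigma> j * (y \<bullet> u j))\<^sup>2) \<le> (onorm T * norm y)\<^sup>2" if F: "F \<subseteq> J" "finite F" for F
    proof -
      have "(\<Sum>j\<in>F. (\<sigma> j * (y \<bullet> u j))\<^sup>2) \<le> (\<Sum>j\<in>F. (onorm T)\<^sup>2 * (y \<bullet> u j)\<^sup>2)"
        unfolding power_mult_distrib
        using F pos svd_singular_value_le_onorm[OF T svd]
        by (intro sum_mono mult_right_mono power_mono) (auto intro: less_imp_le)
      also have "\<dots> \<le> (onorm T)\<^sup>2 * (norm y)\<^sup>2"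
        using Bessel_inequality[OF u F] by (simp add: mult_left_mono flip: sum_distrib_left)
      finally show ?thesis by (simp add: power_mult_distrib)
    qed
    then show "bdd_above (sum (\<lambda>j. (\<sigma> j * (y \<bullet> u j))\<^sup>2) ` {F. F \<subseteq> J \<and> finite F})"
      by (intro bdd_aboveI2[of _ _ "(onorm T * norm y)\<^sup>2"]) auto
  qed simp
  have "T x \<bullet> y = x \<bullet> B y" for x y
  proof -
    have "((\<lambda>j. \<sigma> j * (x \<bullet> v j) * (u j \<bullet> y)) has_sum T x \<bullet> y) J"
      using has_sum_bounded_linear[OF bounded_linear_inner_left[of y] T_sum[of x]] by simp
    moreover have "((\<lambda>j. \<sigma> j * (x \<bullet> v j) * (u j \<bullet> y)) has_sum x \<bullet> B y) J"
      using has_sum_bounded_linear[OF bounded_linear_inner_right[of x] B_sum[of y]]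
      by (simp add: inner_commute mult_ac)
    ultimately show ?thesis by (rule has_sum_unique)
  qed
  moreover from this have "adjoint T = B"
    by (intro adjoint_unique) simp
  ultimately show ?thesis by simp
qed

text \<open>The range of the adjoint is orthogonal to the null space of \<open>T\<close>, whose orthogonal complement
  is the closed span of the right singular vectors.\<close>

lemma svd_expansion_range_adjoint:
  fixes T :: "'a::{real_inner, complete_space} \<Rightarrow> 'b::real_inner"
  assumes T: "bounded_linear T" and svd: "singular_value_decomposition T J u v \<sigma>"
    and x: "x \<in> range (adjoint T)"
  shows "((\<lambda>j. (x \<bullet> v j) *\<^sub>R v j) has_sum x) J"
proof -
  have "x \<in> (null_space T)\<^sup>\<bottom>"
    using x svd_adjoint[OF T svd, symmetric]
    by (auto simp: null_space_def orthogonal_comp_def orthogonal_def)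
  then show ?thesis
    using svd by (intro has_sum_orthonormal_expansion) (auto simp: singular_value_decomposition_def)
qed

lemma svd_adjoint_linear:
  fixes T :: "'a::{real_inner, complete_space} \<Rightarrow> 'b::real_inner"
  assumes T: "bounded_linear T" and svd: "singular_value_decomposition T J u v \<sigma>"
  shows "linear (adjoint T)"
proof -
  note adj = svd_adjoint[OF T svd, symmetric]
  show ?thesis
  proof (rule linearI)
    fix b1 b2
    have "x \<bullet> adjoint T (b1 + b2) = x \<bullet> (adjoint T b1 + adjoint T b2)" for x
      unfolding inner_add_right adj ..
    then show "adjoint T (b1 + b2) = adjoint T b1 + adjoint T b2"
      by (rule vector_eq_ldot[THEN iffD1, OF allI])
  next
    fix r b
    have "x \<bullet> adjoint T (r *\<^sub>R b) = x \<bullet> (r *\<^sub>R adjoint T b)" for x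
      unfolding inner_scaleR_right adj ..
    then show "adjoint T (r *\<^sub>R b) = r *\<^sub>R adjoint T b"
      by (rule vector_eq_ldot[THEN iffD1, OF allI])
  qed
qed

lemma svd_inner_normal_operator:
  fixes T :: "'a::{real_inner, complete_space} \<Rightarrow> 'b::real_inner"
  assumes T: "bounded_linear T" and svd: "singular_value_decomposition T J u v \<sigma>" and j: "j \<in> J"
  shows "adjoint T (T x) \<bullet> v j = (\<sigma> j)\<^sup>2 * (x \<bullet> v j)"
proof -
  have "adjoint T (T x) \<bullet> v j = T (v j) \<bullet> T x"
    by (subst inner_commute) (rule svd_adjoint[OF T svd, symmetric])
  then show ?thesis
    unfolding svd_apply_right_singular_vector[OF svd j]
    using svd_inner_left_singular_vector[OF svd j, of x]
    by (simp add: power2_eq_square inner_commute)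
qed

section \<open>The Lipschitz constant of \<open>Id - T\<^sup>* T\<close>\<close>

text \<open>Estimate \<open>\<parallel>T\<^sup>* y\<parallel>\<^sup>2 = T (T\<^sup>* y) \<bullet> y\<close> by Cauchy--Schwarz and cancel one factor \<open>\<parallel>T\<^sup>* y\<parallel>\<close>.\<close>

lemma norm_adjoint_le:
  assumes T: "bounded_linear T" and adj: "\<And>x y. T x \<bullet> y = x \<bullet> adjoint T y"
  shows "norm (adjoint T y) \<le> onorm T * norm y"
proof (cases "adjoint T y = 0")
  case True
  then show ?thesis by (simp add: onorm_pos_le[OF T])
next
  case False
  have "(norm (adjoint T y))\<^sup>2 = T (adjoint T y) \<bullet> y"
    by (simp add: power2_norm_eq_inner adj)
  also have "\<dots> \<le> norm (T (adjoint T y)) * norm y"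
    by (rule norm_cauchy_schwarz)
  also have "\<dots> \<le> (onorm T * norm (adjoint T y)) * norm y"
    by (intro mult_right_mono onorm[OF T]) simp
  finally show ?thesis
    using False by (simp add: power2_eq_square mult_ac)
qed

text \<open>In the expansion of \<open>\<parallel>x - T\<^sup>* T x\<parallel>\<^sup>2\<close> the cross term is \<open>- 2 \<parallel>T x\<parallel>\<^sup>2\<close>, which outweighs
  \<open>\<parallel>T\<^sup>* T x\<parallel>\<^sup>2 \<le> \<parallel>T x\<parallel>\<^sup>2\<close>. The triangle inequality alone would only give the constant \<open>2\<close>.\<close>

lemma norm_id_minus_normal_operator_le:
  assumes T: "bounded_linear T" "onorm T \<le> 1" and adj: "\<And>x y. T x \<bullet> y = x \<bullet> adjoint T y"
  shows "norm (x - adjoint T (T x)) \<le> norm x"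
proof (rule power2_le_imp_le)
  have "norm (adjoint T (T x)) \<le> onorm T * norm (T x)"
    by (rule norm_adjoint_le[OF T(1) adj])
  also have "\<dots> \<le> norm (T x)"
    using T(2) mult_right_mono[of "onorm T" 1 "norm (T x)"] by simp
  finally have *: "(norm (adjoint T (T x)))\<^sup>2 \<le> (norm (T x))\<^sup>2"
    by (simp add: power_mono)
  have "x \<bullet> adjoint T (T x) = (norm (T x))\<^sup>2"
    by (simp add: power2_norm_eq_inner adj[symmetric])
  then have "(norm (x - adjoint T (T x)))\<^sup>2
      = (norm x)\<^sup>2 - 2 * (norm (T x))\<^sup>2 + (norm (adjoint T (T x)))\<^sup>2"
    by (simp add: power2_norm_eq_inner inner_diff_left inner_diff_right inner_commute)
  then show "(norm (x - adjoint T (T x)))\<^sup>2 \<le> (norm x)\<^sup>2"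
    using * zero_le_power2[of "norm (T x)"] by linarith
qed simp

text \<open>The forward direction is where ill-posedness enters: a lower bound \<open>c \<parallel>x\<parallel> \<le> \<parallel>T x\<parallel>\<close> could make
  the Lipschitz constant of \<open>Id - T\<^sup>* T\<close> smaller than \<open>1\<close> and so admit parameters beyond \<open>L\<close>.\<close>

lemma lipschitz_scaled_id_minus_normal_operator_iff:
  assumes T: "bounded_linear T" "onorm T \<le> 1" and adj: "\<And>x y. T x \<bullet> y = x \<bullet> adjoint T y"
    and lin: "linear (adjoint T)" and ill: "ill_posed T" and L: "0 \<le> L"
  shows "L-lipschitz_on UNIV (\<lambda>x. k *\<^sub>R (x - adjoint T (T x))) \<longleftrightarrow> \<bar>k\<bar> \<le> L"
proof
  assume lip: "L-lipschitz_on UNIV (\<lambda>x. k *\<^sub>R (x - adjoint T (T x)))"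
  show "\<bar>k\<bar> \<le> L"
  proof (rule ccontr)
    assume "\<not> \<bar>k\<bar> \<le> L"
    then have k: "\<bar>k\<bar> > L" "\<bar>k\<bar> > 0" using L by auto
    \<comment> \<open>Chosen such that \<open>\<bar>k\<bar> (1 - c) = L\<close>: a vector shrunk by \<open>T\<close> below the factor \<open>c\<close> breaks the
      Lipschitz bound.\<close>
    define c where "c = 1 - L / \<bar>k\<bar>"
    have "c > 0" using k by (simp add: c_def)
    then obtain x where x: "norm (T x) < c * norm x"
      using ill by (force simp: ill_posed_def not_le)
    have "norm (adjoint T (T x)) \<le> onorm T * norm (T x)"
      by (rule norm_adjoint_le[OF T(1) adj])
    also have "\<dots> \<le> norm (T x)"
      using T(2) mult_right_mono[of "onorm T" 1 "norm (T x)"] by simp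
    finally have "norm (x - adjoint T (T x)) > norm x - c * norm x"
      using norm_triangle_ineq2[of x "adjoint T (T x)"] x by linarith
    then have "\<bar>k\<bar> * norm (x - adjoint T (T x)) > \<bar>k\<bar> * (norm x - c * norm x)"
      using k by simp
    also have "\<bar>k\<bar> * (norm x - c * norm x) = L * norm x"
      using k by (simp add: c_def field_simps)
    finally have "L * norm x < \<bar>k\<bar> * norm (x - adjoint T (T x))" .
    moreover have "T 0 = 0" "adjoint T 0 = 0"
      using T(1) lin by (simp_all add: linear_0 bounded_linear.linear)
    ultimately show False
      using lipschitz_onD[OF lip, of x 0] by simp
  qed
next
  assume k: "\<bar>k\<bar> \<le> L"
  show "L-lipschitz_on UNIV (\<lambda>x. k *\<^sub>R (x - adjoint T (T x)))"
  proof (rule lipschitz_onI)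
    fix x y
    have "k *\<^sub>R (x - adjoint T (T x)) - k *\<^sub>R (y - adjoint T (T y))
        = k *\<^sub>R ((x - y) - adjoint T (T (x - y)))"
      using T(1) lin by (simp add: linear_diff bounded_linear.linear algebra_simps)
    then have "dist (k *\<^sub>R (x - adjoint T (T x))) (k *\<^sub>R (y - adjoint T (T y)))
        = \<bar>k\<bar> * norm ((x - y) - adjoint T (T (x - y)))"
      by (simp add: dist_norm)
    also have "\<dots> \<le> L * norm (x - y)"
      using k L by (intro mult_mono norm_id_minus_normal_operator_le[OF T adj]) auto
    finally show "dist (k *\<^sub>R (x - adjoint T (T x))) (k *\<^sub>R (y - adjoint T (T y))) \<le> L * dist x y"
      by (simp add: dist_norm)
  qed (rule L)
qed

section \<open>Training and inversion\<close>

text \<open>The loss is a positive multiple of \<open>(1 - k)\<^sup>2\<close>, which is strictly decreasing on the admissible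
  interval from \<open>- L\<close> to \<open>L\<close> because \<open>L < 1\<close>.\<close>

lemma solves_training_problem_iff:
  assumes lip: "\<And>k. L-lipschitz_on UNIV (f k) \<longleftrightarrow> \<bar>k\<bar> \<le> L"
    and f: "f = (\<lambda>k y. k *\<^sub>R (y - A y))" and L: "0 \<le> L" "L < 1"
    and data: "\<exists>i\<in>{1..N}. A (x i) \<noteq> x i"
  shows "solves_training_problem A (UNIV :: real set) f L N x k \<longleftrightarrow> k = L"
proof -
  define C where "C = 1 / real N * (\<Sum>i=1..N. (norm (x i - A (x i)))\<^sup>2)"
  obtain i where i: "i \<in> {1..N}" "A (x i) \<noteq> x i" using data by blast
  have "(\<Sum>i=1..N. (norm (x i - A (x i)))\<^sup>2) > 0"
    by (rule sum_pos2[OF _ i(1)]) (use i(2) in auto)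
  then have C: "C > 0" using i(1) by (simp add: C_def)
  have loss: "training_loss A f N x k = (1 - k)\<^sup>2 * C" for k
  proof -
    have "iresnet (f k) (x i) - A (x i) = (1 - k) *\<^sub>R (x i - A (x i))" for i
      by (simp add: iresnet_def f algebra_simps)
    then show ?thesis
      by (simp add: training_loss_def C_def power_mult_distrib mult_ac flip: sum_distrib_left)
  qed
  have solves: "solves_training_problem A UNIV f L N x k \<longleftrightarrow>
      \<bar>k\<bar> \<le> L \<and> (\<forall>k'. \<bar>k'\<bar> \<le> L \<longrightarrow> (1 - k)\<^sup>2 \<le> (1 - k')\<^sup>2)"
    unfolding solves_training_problem_def is_arg_min_linorder using C by (simp add: lip loss)
  have sq: "(1 - k)\<^sup>2 \<le> (1 - k')\<^sup>2 \<longleftrightarrow> k' \<le> k" if "\<bar>k\<bar> \<le> L" "\<bar>k'\<bar> \<le> L" for k k' :: real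
    using that L by (simp add: abs_le_square_iff[symmetric])
  show ?thesis
  proof
    assume "solves_training_problem A UNIV f L N x k"
    then have k: "\<bar>k\<bar> \<le> L" "\<And>k'. \<bar>k'\<bar> \<le> L \<Longrightarrow> (1 - k)\<^sup>2 \<le> (1 - k')\<^sup>2"
      unfolding solves by blast+
    have "L \<le> k" using sq[of k L] k(1) k(2)[of L] L(1) by simp
    then show "k = L" using k(1) by linarith
  next
    assume k: "k = L"
    have "(1 - L)\<^sup>2 \<le> (1 - k')\<^sup>2" if "\<bar>k'\<bar> \<le> L" for k'
      using sq[of L k'] that L(1) by simp
    with k L(1) show "solves_training_problem A UNIV f L N x k"
      unfolding solves by simp
  qed
qed

text \<open>Solving \<open>x - f x = z\<close> means finding a fixed point of the contraction \<open>x \<mapsto> z + f x\<close>.\<close>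

lemma bij_iresnet:
  fixes f :: "'a::{real_normed_vector, complete_space} \<Rightarrow> 'a"
  assumes lip: "L-lipschitz_on UNIV f" and L: "L < 1"
  shows "bij (iresnet f)"
proof -
  have "\<exists>!x. z + f x = x" for z
  proof (rule banach_fix_type)
    show "\<forall>x y. dist (z + f x) (z + f y) \<le> L * dist x y"
      using lipschitz_onD[OF lip] by simp
  qed (use L lipschitz_on_nonneg[OF lip] in simp_all)
  moreover have "z + f x = x \<longleftrightarrow> iresnet f x = z" for x z
    unfolding iresnet_def by (auto simp: algebra_simps)
  ultimately show ?thesis
    by (simp add: bij_iff)
qed

text \<open>The equation for \<open>x\<close> itself shows that \<open>x\<close> inherits from \<open>z\<close> membership in the range of the
  adjoint; without it, the Fourier series would only recover the component of \<open>x\<close> orthogonal to the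
  null space. The equation is diagonal in the right singular vectors, with eigenvalues
  \<open>1 - L + L (\<sigma> j)\<^sup>2\<close>, the reciprocals of the filter values.\<close>

lemma svd_expansion_affine_inverse:
  fixes T :: "'a::{real_inner, complete_space} \<Rightarrow> 'b::real_inner"
  assumes T: "bounded_linear T" and svd: "singular_value_decomposition T J u v \<sigma>"
    and L: "0 < L" "L < 1"
    and z: "z \<in> range (adjoint T)" and x: "x - L *\<^sub>R (x - adjoint T (T x)) = z"
  shows "((\<lambda>j. (filter_function L ((\<sigma> j)\<^sup>2) (z \<bullet> v j) * (z \<bullet> v j)) *\<^sub>R v j) has_sum x) J"
proof -
  have lin: "linear (adjoint T)" by (rule svd_adjoint_linear[OF T svd])
  obtain w where w: "z = adjoint T w" using z by blast
  have "adjoint T (w - L *\<^sub>R T x) = z - L *\<^sub>R adjoint T (T x)"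
    by (simp only: w linear_diff[OF lin] linear_scale[OF lin])
  also have "\<dots> = (1 - L) *\<^sub>R x"
    unfolding x[symmetric] by (simp add: algebra_simps)
  finally have "x = adjoint T ((1 / (1 - L)) *\<^sub>R (w - L *\<^sub>R T x))"
    using L by (simp add: linear_scale[OF lin])
  then have "x \<in> range (adjoint T)" by (rule range_eqI)
  then have series: "((\<lambda>j. (x \<bullet> v j) *\<^sub>R v j) has_sum x) J"
    by (rule svd_expansion_range_adjoint[OF T svd])
  have coeff: "x \<bullet> v j = filter_function L ((\<sigma> j)\<^sup>2) (z \<bullet> v j) * (z \<bullet> v j)" if j: "j \<in> J" for j
  proof -
    define d where "d = 1 - L + L * (\<sigma> j)\<^sup>2"
    have "d > 0" using L by (simp add: d_def add_pos_nonneg)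
    have "z \<bullet> v j = d * (x \<bullet> v j)"
      unfolding x[symmetric] d_def
      by (simp add: inner_diff_left svd_inner_normal_operator[OF T svd j] algebra_simps)
    moreover have "filter_function L ((\<sigma> j)\<^sup>2) s = 1 / d" for s
    proof -
      have "L * ((1 - L) / L + (\<sigma> j)\<^sup>2) = d"
        using L(1) unfolding d_def distrib_left by simp
      then show ?thesis
        unfolding filter_function_def Let_def times_divide_times_eq by (simp only: mult_1)
    qed
    ultimately show ?thesis using \<open>d > 0\<close> by simp
  qed
  from series show ?thesis
    by (rule has_sum_cong[THEN iffD1, rotated]) (simp only: coeff)
qed

theorem lemma4p1:
  fixes \<A> :: "'a::{real_inner, complete_space} \<Rightarrow> 'b::{real_inner, complete_space}"
    and A :: "'a \<Rightarrow> 'a"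
    and J :: "nat set" and u :: "nat \<Rightarrow> 'b" and v :: "nat \<Rightarrow> 'a" and \<sigma> :: "nat \<Rightarrow> real"
    and L :: real and N :: nat and x :: "nat \<Rightarrow> 'a"
    and f :: "real \<Rightarrow> 'a \<Rightarrow> 'a"
  assumes "bounded_linear \<A>" and "onorm \<A> = 1"
    and "singular_value_decomposition \<A> J u v \<sigma>"
    and "ill_posed \<A>"
    and "A = adjoint \<A> \<circ> \<A>"
    and "0 < L" and "L < 1"
    and "f = (\<lambda>k y. k *\<^sub>R (y - A y))"
    and "\<exists>i\<in>{1..N}. A (x i) \<noteq> x i"
  shows "(\<forall>k. solves_training_problem A (UNIV :: real set) f L N x k \<longleftrightarrow> k = L) \<and>
    (\<forall>k. solves_training_problem A (UNIV :: real set) f L N x k \<longrightarrow>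
       bij (iresnet (f k)) \<and>
       (\<forall>z \<in> range (adjoint \<A>).
          ((\<lambda>j. (filter_function L ((\<sigma> j)\<^sup>2) (z \<bullet> v j) * (z \<bullet> v j)) *\<^sub>R v j)
             has_sum inv (iresnet (f k)) z) J))"
proof -
  note T = assms(1) and svd = assms(3)
  note adj = svd_adjoint[OF T svd]
  have f: "f = (\<lambda>k y. k *\<^sub>R (y - adjoint \<A> (\<A> y)))"
    using assms(5,8) by simp
  have lip: "L-lipschitz_on UNIV (f k) \<longleftrightarrow> \<bar>k\<bar> \<le> L" for k
    unfolding f using assms(2,4,6) adj svd_adjoint_linear[OF T svd]
    by (intro lipschitz_scaled_id_minus_normal_operator_iff[OF T]) auto
  have sol: "solves_training_problem A UNIV f L N x k \<longleftrightarrow> k = L" for k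
    using assms(6,7) by (intro solves_training_problem_iff[OF lip assms(8) _ _ assms(9)]) auto
  have bij: "bij (iresnet (f L))"
    using lip[of L] assms(6,7) by (intro bij_iresnet) auto
  have "((\<lambda>j. (filter_function L ((\<sigma> j)\<^sup>2) (z \<bullet> v j) * (z \<bullet> v j)) *\<^sub>R v j)
      has_sum inv (iresnet (f L)) z) J" if z: "z \<in> range (adjoint \<A>)" for z
  proof (rule svd_expansion_affine_inverse[OF T svd assms(6,7) z])
    show "inv (iresnet (f L)) z -
        L *\<^sub>R (inv (iresnet (f L)) z - adjoint \<A> (\<A> (inv (iresnet (f L)) z))) = z"
      using surj_f_inv_f[OF bij_is_surj[OF bij], of z] unfolding iresnet_def f .
  qed
  with bij show ?thesis
    unfolding sol by simp
qed

end
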